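(* If $r\ge 1$ and $n\ge r$ are integers, then $$\left|D_r(n)-\frac{n!}{e}\binom{n-1}{r}\right|<2\,n!\binom{n-1}{r-1}.$$ In particular, for each integer $r\ge 1$ the sequence $\left(\frac{D_r(n)}{(n+r)!}\right)_{n\ge 0}$ converges to $\frac{1}{r!\,e}$.
   Context: For integers $n,r\ge 0$, the $r$-derangement number $D_r(n)$ is the number of permutations of $\{1,\dots,n+r\}$ that have no fixed points and in whose cycle decomposition the elements $1,\dots,r$ lie in pairwise distinct cycles. Here $e$ is the base of the natural logarithm, and $\binom{a}{b}=0$ when $0\le a<b$. *)

theory Defs
  imports Complex_Main "HOL-Combinatorics.Combinatorics"
begin

text \<open>For a permutation \<open>p\<close> of a finite set, the cycle containing \<open>i\<close> has underlying
  set \<open>orbit p i\<close>, so injectivity of \<open>orbit p\<close> on \<open>{1..r}\<close> says that the elements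
  \<open>1, \<dots>, r\<close> lie in pairwise distinct cycles.\<close>

definition r_derangements :: "nat \<Rightarrow> nat \<Rightarrow> (nat \<Rightarrow> nat) set" where
  "r_derangements r n =
     {p. p permutes {1..n + r} \<and> (\<forall>i\<in>{1..n + r}. p i \<noteq> i) \<and> inj_on (orbit p) {1..r}}"

definition r_derangement_number :: "nat \<Rightarrow> nat \<Rightarrow> nat" where
  "r_derangement_number r n = card (r_derangements r n)"

end

theory Submission
  imports Defs "HOL-Real_Asymp.Real_Asymp"
begin

text \<open>Permutations of an \<open>(r + m)\<close>-set that separate \<open>r\<close> given elements number
  \<open>(r + m)! / r!\<close>: each further element is inserted into an existing cycle or becomes a
  fixed point. Forbidding the fixed points one at a time, with a fixed point simply removed from
  the set, gives \<open>m! (m choose r)\<close> when the special elements may not be fixed, and then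
  \<open>D\<^sub>r(n) = n! (\<Sum>j\<le>n. (-1)\<^sup>j / j! (n - j choose r))\<close>.
  Summation by parts replaces \<open>(-1)\<^sup>j / j!\<close> by its partial sums \<open>s\<^sub>j\<close>, against the weights
  \<open>(n - 1 - j choose r - 1)\<close>. Since \<open>s\<^sub>j\<close> is within \<open>2\<^sup>-\<^sup>j\<close> of \<open>1 / e\<close>, the terms with
  \<open>j \<ge> 1\<close> give the main term with an error below \<open>n! (n - 1 choose r - 1)\<close>, and the term
  \<open>j = 0\<close> contributes exactly \<open>n! (n - 1 choose r - 1)\<close>.\<close>

section \<open>Counting permutations that separate the special elements\<close>

text \<open>\<open>K\<close> varies independently of \<open>A\<close> and \<open>R\<close>, so that
  fixed points can be forbidden one at a time; r-derangements are the case
  \<open>K = A\<close>.\<close>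

definition separating_perms :: "'a set \<Rightarrow> 'a set \<Rightarrow> 'a set \<Rightarrow> ('a \<Rightarrow> 'a) set" where
  "separating_perms A R K = {p. p permutes A \<and> inj_on (orbit p) R \<and> (\<forall>i\<in>K. p i \<noteq> i)}"

lemma finite_separating_perms: "finite A \<Longrightarrow> finite (separating_perms A R K)"
  unfolding separating_perms_def by (rule finite_subset[OF _ finite_permutations[of A]]) auto

text \<open>Cycles of a finite permutation are equivalence classes. This trades equality of orbits
  for membership, which induction over \<open>orbit\<close> can handle.\<close>

lemma permutes_orbit_eq_iff:
  assumes "finite A" "p permutes A"
  shows "orbit p x = orbit p y \<longleftrightarrow> y \<in> orbit p x"
proof -
  have "permutation p"
    using assms permutation_permutes by blast
  then have *: "z \<in> orbit p z" for z
    by (rule permutation_self_in_orbit)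
  show ?thesis
  proof
    assume "y \<in> orbit p x"
    moreover from this have "x \<in> orbit p y"
      using * orbit_swap by metis
    ultimately show "orbit p x = orbit p y"
      by (auto intro: orbit_trans)
  qed (use * in auto)
qed

text \<open>Composing with \<open>transpose a b\<close> inserts \<open>a\<close> just before \<open>b\<close> in its cycle, or leaves it
  fixed if \<open>b = a\<close>.\<close>

lemma in_orbit_transpose_comp_iff:
  assumes q: "q permutes A" and a: "a \<notin> A" and x: "x \<in> A" and y: "y \<in> A"
  shows "y \<in> orbit (transpose a b \<circ> q) x \<longleftrightarrow> y \<in> orbit q x"
proof
  have qa: "q a = a"
    using q a by (simp add: permutes_def)
  have qne: "q z \<noteq> a" if "z \<noteq> a" for z
    using that qa permutes_inj[OF q] by (metis injD)
  have xa: "x \<noteq> a"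
    using x a by auto
  let ?p = "transpose a b \<circ> q"
  show "y \<in> orbit q x" if "y \<in> orbit ?p x"
  proof -
    \<comment> \<open>The induction also passes through \<open>a\<close>. As \<open>?p\<close> maps
      \<open>a\<close> to \<open>b\<close>, standing at \<open>a\<close> is recorded as
      \<open>b\<close> being reachable under \<open>q\<close>.\<close>
    from that have "if y = a then b \<in> orbit q x else y \<in> orbit q x"
    proof (induction rule: orbit.induct)
      case base
      show ?case
        using qne[OF xa] orbit.base[of q x] by (auto simp: transpose_def)
    next
      case (step z)
      show ?case
      proof (cases "z = a")
        case True
        then show ?thesis
          using step.IH qa by (auto simp: transpose_def)
      next
        case False
        then show ?thesis
          using step.IH qne[OF False] orbit.step[of z q x] by (auto simp: transpose_def)
      qed
    qed
    then show ?thesis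
      using y a by (auto split: if_splits)
  qed
  show "y \<in> orbit ?p x" if "y \<in> orbit q x"
  proof -
    \<comment> \<open>One step of \<open>q\<close> is one step of \<open>?p\<close>, or two steps
      through \<open>a\<close> when \<open>q z = b\<close>.\<close>
    have move: "q z \<in> orbit ?p x" if "z \<noteq> a" "?p z \<in> orbit ?p x" for z
    proof (cases "q z = b")
      case True
      then have "?p z = a"
        by (simp add: transpose_def)
      then have "?p a \<in> orbit ?p x"
        using that(2) orbit.step[of a ?p x] by simp
      then show ?thesis
        using True qa by simp
    next
      case False
      then have "?p z = q z"
        using qne[OF that(1)] by (simp add: transpose_def)
      then show ?thesis
        using that(2) by simp
    qed
    from that have "y \<noteq> a \<and> y \<in> orbit ?p x"
    proof (induction rule: orbit.induct)
      case base
      show ?case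
        using move[OF xa orbit.base] qne[OF xa] by blast
    next
      case (step z)
      then show ?case
        using move[of z] qne[of z] orbit.step[of z ?p x] by blast
    qed
    then show ?thesis ..
  qed
qed

text \<open>The factor counts the positions \<open>b\<close> for \<open>a\<close>, including
  \<open>b = a\<close>. Since \<open>a\<close> is not special, inserting it does not change which
  elements of \<open>R\<close> share a cycle.\<close>

lemma card_separating_perms_insert:
  assumes A: "finite A" and a: "a \<notin> A" and R: "R \<subseteq> A"
  shows "card (separating_perms (insert a A) R {}) = Suc (card A) * card (separating_perms A R {})"
proof -
  let ?h = "\<lambda>(b, p). transpose a b \<circ> p"
  have inj_eq: "inj_on (orbit (transpose a b \<circ> q)) R \<longleftrightarrow> inj_on (orbit q) R"
    if b: "b \<in> insert a A" and q: "q permutes A" for b q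
  proof -
    have p: "transpose a b \<circ> q permutes insert a A"
      using b q by (intro permutes_compose permutes_swap_id permutes_imp_permutes_insert) auto
    have "orbit (transpose a b \<circ> q) x = orbit (transpose a b \<circ> q) y \<longleftrightarrow> orbit q x = orbit q y"
      if "x \<in> R" "y \<in> R" for x y
      unfolding permutes_orbit_eq_iff[OF A q] permutes_orbit_eq_iff[OF finite.insertI[OF A] p]
      using that R by (intro in_orbit_transpose_comp_iff[OF q a]) auto
    then show ?thesis
      by (auto simp: inj_on_def)
  qed
  have "separating_perms (insert a A) R {} = ?h ` (insert a A \<times> separating_perms A R {})"
  proof -
    have "separating_perms (insert a A) R {} =
        {p \<in> {p. p permutes (insert a A)}. inj_on (orbit p) R}"
      by (auto simp: separating_perms_def)
    also have "\<dots> = ?h ` {(b, p). b \<in> insert a A \<and> p permutes A \<and> inj_on (orbit p) R}"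
      unfolding permutes_insert using inj_eq by (auto simp: image_iff)
    finally show ?thesis
      by (auto simp: separating_perms_def image_iff)
  qed
  moreover have "inj_on ?h (insert a A \<times> separating_perms A R {})"
  proof (rule inj_onI, clarify)
    fix b p c q
    assume *: "p \<in> separating_perms A R {}" "q \<in> separating_perms A R {}"
      "transpose a b \<circ> p = transpose a c \<circ> q"
    \<comment> \<open>Evaluating the composites at \<open>a\<close> therefore recovers
      \<open>b\<close> and \<open>c\<close>.\<close>
    then have "p a = a" "q a = a"
      using a by (auto simp: separating_perms_def permutes_def)
    with *(3) have "b = c"
      by (metis comp_apply transpose_apply_first)
    moreover from this *(3) have "p = q"
      by (metis comp_assoc comp_id id_comp transpose_comp_involutory)
    ultimately show "b = c \<and> p = q"
      by simp
  qed
  ultimately show ?thesis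
    using A a by (simp add: card_image card_cartesian_product)
qed

text \<open>Base case of the insertion count: \<open>x\<close> and \<open>p x\<close> share a cycle,
  so separation forces \<open>p x = x\<close>.\<close>

lemma separating_perms_self:
  assumes "finite R"
  shows "separating_perms R R {} = {id}"
proof -
  have "p = id" if p: "p permutes R" and inj: "inj_on (orbit p) R" for p
  proof
    fix x
    show "p x = id x"
    proof (cases "x \<in> R")
      case True
      have "orbit p x = orbit p (p x)"
        using permutes_orbit_eq_iff[OF assms p] orbit.base by metis
      then show ?thesis
        using inj True permutes_in_image[OF p, of x] by (auto dest: inj_onD)
    next
      case False
      then show ?thesis
        using p by (simp add: permutes_def)
    qed
  qed
  moreover have "inj_on (orbit id) R"
  proof -
    have "z = x" if "z \<in> orbit id x" for x z :: 'a
      using that by (induction rule: orbit.induct) simp_all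
    then show ?thesis
      using permutes_orbit_eq_iff[OF assms permutes_id] by (auto simp: inj_on_def)
  qed
  ultimately show ?thesis
    by (auto simp: separating_perms_def)
qed

lemma card_separating_perms_empty:
  assumes "finite R" "finite M" "R \<inter> M = {}"
  shows "card (separating_perms (R \<union> M) R {}) * fact (card R) = fact (card R + card M)"
  using assms(2,3)
proof (induction M rule: finite_induct)
  case empty
  then show ?case
    using assms(1) by (simp add: separating_perms_self)
next
  case (insert a M)
  have "card (R \<union> M) = card R + card M"
    using insert assms(1) by (intro card_Un_disjoint) auto
  moreover have "card (separating_perms (insert a (R \<union> M)) R {}) =
      Suc (card (R \<union> M)) * card (separating_perms (R \<union> M) R {})"
    using insert assms(1) by (intro card_separating_perms_insert) auto
  ultimately have "card (separating_perms (R \<union> insert a M) R {}) * fact (card R) =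
      Suc (card R + card M) * (card (separating_perms (R \<union> M) R {}) * fact (card R))"
    by (simp add: algebra_simps)
  also have "\<dots> = fact (card R + card (insert a M))"
    using insert by simp
  finally show ?case .
qed

section \<open>Forbidding fixed points\<close>

text \<open>Permutations with \<open>p x = x\<close> are those of \<open>A - {x}\<close>. A fixed
  \<open>x\<close> is alone in its cycle, so it is separated from the rest automatically and may
  leave \<open>R\<close> as well.\<close>

lemma card_separating_perms_split:
  assumes A: "finite A" and x: "x \<in> A" "x \<notin> K"
  shows "card (separating_perms A R K) =
    card (separating_perms A R (insert x K)) + card (separating_perms (A - {x}) (R - {x}) K)"
proof -
  have fix_eq: "p permutes A \<and> p x = x \<longleftrightarrow> p permutes (A - {x})" for p
  proof
    assume "p permutes A \<and> p x = x"
    then show "p permutes (A - {x})"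
      by (auto intro: permutes_superset[of p A])
  next
    assume p: "p permutes (A - {x})"
    then have "p x = x"
      by (simp add: permutes_def)
    with p show "p permutes A \<and> p x = x"
      using permutes_subset[OF p, of A] by auto
  qed
  have inj_eq: "inj_on (orbit p) R \<longleftrightarrow> inj_on (orbit p) (R - {x})"
    if p: "p permutes A" and px: "p x = x" for p
  proof
    assume inj: "inj_on (orbit p) (R - {x})"
    have "z = x" if "z \<in> orbit p x" for z
      using that by (induction rule: orbit.induct) (simp_all add: px)
    then have "y = x" if "orbit p x = orbit p y" for y
      using that permutes_orbit_eq_iff[OF A p] by blast
    then show "inj_on (orbit p) R"
      using inj unfolding inj_on_def by (metis DiffI singletonD)
  qed (auto intro: inj_on_subset)
  have "separating_perms A R K =
      separating_perms A R (insert x K) \<union> {p \<in> separating_perms A R K. p x = x}"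
    by (auto simp: separating_perms_def)
  also have "{p \<in> separating_perms A R K. p x = x} = separating_perms (A - {x}) (R - {x}) K"
    using fix_eq inj_eq by (auto simp: separating_perms_def)
  finally have eq: "separating_perms A R K =
      separating_perms A R (insert x K) \<union> separating_perms (A - {x}) (R - {x}) K" .
  show ?thesis
    unfolding eq using A
    by (intro card_Un_disjoint finite_separating_perms)
       (auto simp: separating_perms_def permutes_def)
qed

text \<open>Deleting a special \<open>x\<close> from both \<open>A\<close> and \<open>R\<close>
  keeps \<open>A - R\<close>, so the splitting recursion becomes Pascal's rule with upper index
  \<open>card (A - K)\<close>.\<close>

lemma card_separating_perms_no_fixed_special:
  assumes "finite K" "finite A" "R \<subseteq> A" "K \<subseteq> R"
  shows "card (separating_perms A R K) =
    fact (card (A - R)) * (card (A - K) choose card R)"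
  using assms
proof (induction K arbitrary: A R rule: finite_induct)
  case empty
  have fin: "finite R"
    using empty finite_subset by blast
  have A: "R \<union> (A - R) = A"
    using empty by auto
  have cA: "card A = card R + card (A - R)"
    using card_Un_disjoint[OF fin, of "A - R"] empty A by auto
  have "card (separating_perms A R {}) * fact (card R) = fact (card A)"
    using card_separating_perms_empty[OF fin, of "A - R"] empty A cA by auto
  also have "\<dots> = fact (card R) * fact (card A - card R) * (card A choose card R)"
    using binomial_fact_lemma[of "card R" "card A"] cA by (simp add: mult_ac)
  also have "\<dots> = fact (card (A - R)) * (card A choose card R) * fact (card R)"
    using cA by simp
  finally show ?case
    by simp
next
  case (insert x K)
  from insert.prems insert.hyps have x: "x \<in> R" "x \<in> A" "R - {x} \<subseteq> A - {x}" "K \<subseteq> R - {x}"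
    by auto
  have fin: "finite R"
    by (rule finite_subset[OF insert.prems(2,1)])
  obtain r where r: "card R = Suc r" "card (R - {x}) = r"
    using card.remove[OF fin x(1)] by simp
  have "A - insert x K = A - K - {x}"
    by auto
  then have cK: "card (A - K) = Suc (card (A - insert x K))"
    using card.remove[of "A - K" x] insert.prems(1) insert.hyps x(2) by simp
  have e: "A - {x} - (R - {x}) = A - R" "A - {x} - K = A - insert x K"
    using x by auto
  have "card (separating_perms A R K) =
      card (separating_perms A R (insert x K)) + card (separating_perms (A - {x}) (R - {x}) K)"
    using insert.prems insert.hyps x by (intro card_separating_perms_split) auto
  moreover have "card (separating_perms A R K) =
      fact (card (A - R)) * (Suc (card (A - insert x K)) choose Suc r)"
    using insert.IH[of A R] insert.prems r cK by simp
  moreover have "card (separating_perms (A - {x}) (R - {x}) K) =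
      fact (card (A - R)) * (card (A - insert x K) choose r)"
    using insert.IH[OF _ x(3,4)] insert.prems r e by simp
  ultimately show ?case
    by (simp add: r algebra_simps)
qed

text \<open>The sum is the \<open>l\<close>-th iterated difference of \<open>g\<close> at 0 (up to
  sign), and Pascal's rule takes one more difference. This drives the inclusion-exclusion
  below.\<close>

lemma alternating_binomial_sum_Suc:
  fixes g :: "nat \<Rightarrow> 'a::comm_ring_1"
  shows "(\<Sum>j\<le>Suc l. (-1) ^ j * of_nat (Suc l choose j) * g j) =
    (\<Sum>j\<le>l. (-1) ^ j * of_nat (l choose j) * g j) -
    (\<Sum>j\<le>l. (-1) ^ j * of_nat (l choose j) * g (Suc j))"
proof -
  have "(\<Sum>j\<le>Suc l. (-1) ^ j * of_nat (Suc l choose j) * g j) =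
      g 0 + (\<Sum>j\<le>l. (-1) ^ Suc j * of_nat (Suc l choose Suc j) * g (Suc j))"
    by (subst sum.atMost_Suc_shift) simp
  also have "\<dots> = (g 0 + (\<Sum>j\<le>l. (-1) ^ Suc j * of_nat (l choose Suc j) * g (Suc j))) -
      (\<Sum>j\<le>l. (-1) ^ j * of_nat (l choose j) * g (Suc j))"
    by (simp add: algebra_simps sum.distrib sum_negf sum_subtractf)
  also have "g 0 + (\<Sum>j\<le>l. (-1) ^ Suc j * of_nat (l choose Suc j) * g (Suc j)) =
      (\<Sum>j\<le>Suc l. (-1) ^ j * of_nat (l choose j) * g j)"
    by (subst sum.atMost_Suc_shift) simp
  also have "\<dots> = (\<Sum>j\<le>l. (-1) ^ j * of_nat (l choose j) * g j)"
    by (simp add: binomial_eq_0)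
  finally show ?thesis .
qed

text \<open>Inclusion-exclusion over \<open>L\<close>, starting from \<open>K = R\<close>. Deleting
  a non-special point leaves \<open>R\<close> intact and lowers \<open>card (A - R)\<close> by one,
  which shifts \<open>j\<close> to \<open>Suc j\<close>.\<close>

lemma card_separating_perms_no_fixed:
  assumes "finite L" "finite A" "R \<subseteq> A" "L \<subseteq> A - R"
  shows "real (card (separating_perms A R (R \<union> L))) =
    (\<Sum>j\<le>card L. (-1) ^ j * real (card L choose j) *
      (fact (card (A - R) - j) * real ((card (A - R) - j) choose card R)))"
  using assms
proof (induction L arbitrary: A rule: finite_induct)
  case empty
  then show ?case
    using card_separating_perms_no_fixed_special[of R A R] finite_subset[of R A] by simp
next
  case (insert x L)
  let ?g = "\<lambda>m. fact m * real (m choose card R)"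
  have x: "x \<in> A" "x \<notin> R" "R \<subseteq> A - {x}" "L \<subseteq> A - {x} - R" "R - {x} = R"
    using insert by auto
  have "A - {x} - R = (A - R) - {x}"
    by auto
  then have c: "card (A - {x} - R) - j = card (A - R) - Suc j" for j
    using x insert by simp
  have "card (separating_perms A R (R \<union> L)) =
      card (separating_perms A R (insert x (R \<union> L))) +
      card (separating_perms (A - {x}) (R - {x}) (R \<union> L))"
    using insert x by (intro card_separating_perms_split) auto
  then have "real (card (separating_perms A R (R \<union> insert x L))) =
      real (card (separating_perms A R (R \<union> L))) -
      real (card (separating_perms (A - {x}) R (R \<union> L)))"
    by (simp add: x)
  also have "\<dots> =
      (\<Sum>j\<le>card L. (-1) ^ j * real (card L choose j) * ?g (card (A - R) - j)) -
      (\<Sum>j\<le>card L. (-1) ^ j * real (card L choose j) * ?g (card (A - R) - Suc j))"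
    using insert.IH[of A] insert.IH[of "A - {x}"] insert x c by simp
  also have "\<dots> = (\<Sum>j\<le>Suc (card L). (-1) ^ j * real (Suc (card L) choose j) *
      ?g (card (A - R) - j))"
    by (rule alternating_binomial_sum_Suc[symmetric])
  finally show ?case
    using insert by simp
qed

text \<open>Here \<open>L\<close> is the set of all \<open>n\<close> non-special elements, and
  \<open>(n choose j) * fact (n - j)\<close> simplifies to \<open>fact n / fact j\<close>.\<close>

lemma r_derangement_number_eq_sum:
  "real (r_derangement_number r n) =
    fact n * (\<Sum>j\<le>n. (-1) ^ j / fact j * real ((n - j) choose r))"
proof -
  have s: "{1..n + r} - {1..r} = {r + 1..n + r}" "{1..r} \<union> {r + 1..n + r} = {1..n + r}"
    by auto
  have "r_derangements r n = separating_perms {1..n + r} {1..r} ({1..r} \<union> {r + 1..n + r})"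
    unfolding s by (auto simp: r_derangements_def separating_perms_def)
  then have "real (r_derangement_number r n) =
      (\<Sum>j\<le>n. (-1) ^ j * real (n choose j) * (fact (n - j) * real ((n - j) choose r)))"
    using card_separating_perms_no_fixed[of "{r + 1..n + r}" "{1..n + r}" "{1..r}"]
    by (simp add: r_derangement_number_def s del: One_nat_def)
  also have "\<dots> = fact n * (\<Sum>j\<le>n. (-1) ^ j / fact j * real ((n - j) choose r))"
    unfolding sum_distrib_left
    by (intro sum.cong) (auto simp: binomial_fact field_simps)
  finally show ?thesis .
qed

section \<open>Summation by parts and the error bound\<close>

lemma sum_binomial_by_parts:
  fixes a :: "nat \<Rightarrow> 'a::comm_ring_1"
  shows "(\<Sum>j\<le>n. a j * of_nat ((n - j) choose Suc r)) =
    (\<Sum>j<n. (\<Sum>i\<le>j. a i) * of_nat ((n - 1 - j) choose r))"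
proof -
  \<comment> \<open>Truncating at \<open>k\<close> exposes the boundary term. At
    \<open>k = n\<close> it vanishes, as does the summand \<open>j = n\<close>, because
    \<open>0 choose Suc r = 0\<close>.\<close>
  have "(\<Sum>j<k. a j * of_nat ((n - j) choose Suc r)) -
      (\<Sum>i<k. a i) * of_nat ((n - k) choose Suc r) =
      (\<Sum>j<k. (\<Sum>i\<le>j. a i) * of_nat ((n - 1 - j) choose r))"
    if "k \<le> n" for k
    using that
  proof (induction k)
    case (Suc k)
    define m where "m = n - Suc k"
    have m: "n - k = Suc m" "n - 1 - k = m" "n - Suc k = m"
      using Suc.prems by (auto simp: m_def)
    show ?case
      using Suc by (simp add: m lessThan_Suc_atMost[symmetric] algebra_simps)
  qed simp
  from this[of n] show ?thesis
    by (simp add: lessThan_Suc_atMost[symmetric])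
qed

text \<open>The Lagrange remainder at -1 has \<open>t < 0\<close>, so it is at most
  \<open>1 / fact (Suc j)\<close>. The cruder power of 1/2 is easy to sum.\<close>

lemma exp_minus_one_partial_sum_le:
  "\<bar>(\<Sum>i\<le>j. (-1) ^ i / fact i) - 1 / exp 1\<bar> \<le> (1 / 2 :: real) ^ j"
proof -
  obtain t :: real where t: "t < 0"
    "exp (-1) = (\<Sum>m<Suc j. exp 0 / fact m * (-1) ^ m) + exp t / fact (Suc j) * (-1) ^ Suc j"
    using Maclaurin_minus[of "-1" "Suc j" "\<lambda>_. exp" exp] by (auto intro: DERIV_exp)
  have "(\<Sum>m<Suc j. exp 0 / fact m * (-1) ^ m) = (\<Sum>i\<le>j. (-1) ^ i / fact i :: real)"
    by (simp add: lessThan_Suc_atMost)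
  with t(2) have "(\<Sum>i\<le>j. (-1) ^ i / fact i) - 1 / exp 1 = - (exp t / fact (Suc j) * (-1) ^ Suc j)"
    by (simp add: exp_minus inverse_eq_divide)
  then have "\<bar>(\<Sum>i\<le>j. (-1) ^ i / fact i) - 1 / exp 1\<bar> = exp t / fact (Suc j)"
    by (simp add: abs_mult power_abs del: fact_Suc)
  also have "\<dots> \<le> 1 / fact (Suc j)"
    using t(1) by (intro divide_right_mono) auto
  also have "\<dots> \<le> 1 / 2 ^ j"
  proof -
    have "(2::real) ^ j \<le> fact (Suc j)"
    proof (induction j)
      case (Suc j)
      then have "(2::real) * 2 ^ j \<le> real (Suc (Suc j)) * fact (Suc j)"
        by (intro mult_mono) auto
      then show ?case
        by (simp add: fact_Suc[of "Suc j"] del: fact_Suc)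
    qed simp
    then show ?thesis
      by (intro divide_left_mono) auto
  qed
  finally show ?thesis
    by (simp add: power_one_over)
qed

text \<open>A finite geometric sum stays strictly below its limit; this makes the final bound
  strict.\<close>

lemma sum_half_powers_less: "(\<Sum>j\<in>{1..<n}. (1 / 2 :: real) ^ j) < 1"
proof -
  have "(\<Sum>j\<in>{1..<Suc n}. (1 / 2 :: real) ^ j) = 1 - (1 / 2) ^ n" for n
    by (induction n) (auto simp: field_simps)
  from this[of "n - 1"] show ?thesis
    by (cases n) auto
qed

lemma r_derangement_number_bound:
  assumes "1 \<le> r" "r \<le> n"
  shows "\<bar>real (r_derangement_number r n) - fact n / exp 1 * real ((n - 1) choose r)\<bar>
    < 2 * fact n * real ((n - 1) choose (r - 1))"
proof -
  obtain q m where r: "r = Suc q" and n: "n = Suc m"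
    using assms by (cases r; cases n) auto
  define s :: "nat \<Rightarrow> real" where "s j = (\<Sum>i\<le>j. (-1) ^ i / fact i)" for j
  \<comment> \<open>\<open>B\<close> is the weight at \<open>j = 0\<close>, where
    \<open>s 0 = 1\<close>; it also dominates every later weight.\<close>
  define B where "B = real (m choose q)"
  define d where "d = (\<Sum>j\<in>{1..<n}. (s j - 1 / exp 1) * real ((m - j) choose q))"
  have B: "B > 0"
    using assms r n by (simp add: B_def)
  have split0: "(\<Sum>j<n. f j) = f 0 + (\<Sum>j\<in>{1..<n}. f j)" for f :: "nat \<Rightarrow> real"
    using sum.atLeast_Suc_lessThan[of 0 n f] n by (simp add: lessThan_atLeast0)
  \<comment> \<open>Summation by parts for the indicator of 0, whose partial sums are all 1, gives
    the hockey-stick identity. Pascal's rule then removes the term \<open>j = 0\<close>.\<close>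
  have "real (n choose r) = (\<Sum>j<n. real ((m - j) choose q))"
    using sum_binomial_by_parts[of "\<lambda>j. if j = 0 then 1 else 0 :: real" n q]
    by (simp add: r n if_distrib[of "\<lambda>x. x * _"] sum.delta' cong: if_cong)
  then have tail: "real (m choose r) = (\<Sum>j\<in>{1..<n}. real ((m - j) choose q))"
    unfolding split0 by (simp add: r n)
  have "real (r_derangement_number r n) = fact n * (\<Sum>j<n. s j * real ((m - j) choose q))"
    unfolding r_derangement_number_eq_sum r sum_binomial_by_parts s_def by (simp add: n)
  also have "\<dots> = fact n * (B + (\<Sum>j\<in>{1..<n}. s j * real ((m - j) choose q)))"
    unfolding split0 by (simp add: s_def B_def)
  \<comment> \<open>Replacing \<open>s j\<close> by \<open>1 / exp 1\<close> for
    \<open>j \<ge> 1\<close> yields exactly the main term; \<open>d\<close> collects the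
    deviations.\<close>
  also have "\<dots> = fact n * (B + d) + fact n / exp 1 * real (m choose r)"
    unfolding tail d_def
    by (simp add: algebra_simps sum_subtractf sum_distrib_left sum_divide_distrib)
  finally have eq: "real (r_derangement_number r n) - fact n / exp 1 * real (m choose r) =
      fact n * (B + d)"
    by simp
  have "\<bar>d\<bar> \<le> (\<Sum>j\<in>{1..<n}. \<bar>(s j - 1 / exp 1) * real ((m - j) choose q)\<bar>)"
    unfolding d_def by (rule sum_abs)
  also have "\<dots> \<le> (\<Sum>j\<in>{1..<n}. (1 / 2) ^ j * B)"
    unfolding abs_mult B_def s_def
    by (intro sum_mono mult_mono exp_minus_one_partial_sum_le) (auto intro: binomial_right_mono)
  also have "\<dots> < B"
    using B sum_half_powers_less[of n] by (simp add: sum_distrib_right[symmetric])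
  finally have "\<bar>B + d\<bar> < 2 * B"
    using B by linarith
  then have "\<bar>fact n * (B + d)\<bar> < fact n * (2 * B)"
    by (simp add: abs_mult)
  then show ?thesis
    using eq by (simp add: B_def r n)
qed

section \<open>The limit of the normalized numbers\<close>

text \<open>Up to \<open>1 / fact r\<close>, the quotient is a product of \<open>r\<close> factors,
  each tending to 1, and \<open>r\<close> is fixed.\<close>

lemma fact_binomial_over_fact_tendsto:
  "(\<lambda>n. fact n * real ((n - 1) choose r) / fact (n + r)) \<longlonglongrightarrow> 1 / fact r"
proof -
  have factor: "(\<lambda>n. (real n - 1 - real i) / (real n + 1 + real i)) \<longlonglongrightarrow> 1" for i
    by real_asymp
  have "(\<lambda>n. (\<Prod>i<r. (real n - 1 - real i) / (real n + 1 + real i)) / fact r)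
      \<longlonglongrightarrow> (\<Prod>i<r. 1) / fact r"
    by (intro tendsto_intros factor) simp
  moreover have "eventually (\<lambda>n. (\<Prod>i<r. (real n - 1 - real i) / (real n + 1 + real i)) / fact r
      = fact n * real ((n - 1) choose r) / fact (n + r)) sequentially"
    \<comment> \<open>For \<open>n \<ge> 1\<close> the truncated \<open>n - 1\<close> agrees with
      real subtraction.\<close>
    using eventually_ge_at_top[of 1]
  proof eventually_elim
    case (elim n)
    have "fact (n + r) = fact n * (\<Prod>i<r. real n + 1 + real i)"
      by (induction r) (simp_all add: algebra_simps)
    moreover have "real ((n - 1) choose r) = (\<Prod>i<r. real n - 1 - real i) / fact r"
      using elim by (simp add: binomial_gbinomial gbinomial_prod_rev of_nat_diff lessThan_atLeast0)
    ultimately show ?case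
      by (simp add: prod_dividef)
  qed
  ultimately show ?thesis
    by (simp add: tendsto_cong)
qed

lemma r_derangement_number_tendsto:
  assumes "1 \<le> r"
  shows "(\<lambda>n. real (r_derangement_number r n) / fact (n + r)) \<longlonglongrightarrow> 1 / (fact r * exp 1)"
proof -
  obtain q where r: "r = Suc q"
    using assms by (cases r) auto
  \<comment> \<open>\<open>u r\<close> carries the main term and \<open>u q\<close> the error bound;
    \<open>fact (n + r) = (n + r) * fact (n + q)\<close> supplies the extra factor that sends the
    error to 0.\<close>
  define u :: "nat \<Rightarrow> nat \<Rightarrow> real"
    where "u k n = fact n * real ((n - 1) choose k) / fact (n + k)" for k n
  have u: "u k \<longlonglongrightarrow> 1 / fact k" for k
    unfolding u_def by (rule fact_binomial_over_fact_tendsto)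
  have "(\<lambda>n. inverse (real (n + r))) \<longlonglongrightarrow> 0"
    using LIMSEQ_ignore_initial_segment[OF lim_inverse_n'] by (simp add: inverse_eq_divide)
  then have "(\<lambda>n. 2 * u q n * inverse (real (n + r))) \<longlonglongrightarrow> 2 * (1 / fact q) * 0"
    by (intro tendsto_intros u)
  then have bound: "(\<lambda>n. 2 * u q n * inverse (real (n + r))) \<longlonglongrightarrow> 0"
    by simp
  have "(\<lambda>n. real (r_derangement_number r n) / fact (n + r) - u r n / exp 1) \<longlonglongrightarrow> 0"
  proof (rule tendsto_0_le[OF bound, where K = 1])
    show "eventually (\<lambda>n. norm (real (r_derangement_number r n) / fact (n + r) - u r n / exp 1)
        \<le> norm (2 * u q n * inverse (real (n + r))) * 1) sequentially"
      using eventually_ge_at_top[of r]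
    proof eventually_elim
      case (elim n)
      have "real (r_derangement_number r n) / fact (n + r) - u r n / exp 1 =
          (real (r_derangement_number r n) - fact n / exp 1 * real ((n - 1) choose r)) / fact (n + r)"
        by (simp add: u_def diff_divide_distrib)
      then have "norm (real (r_derangement_number r n) / fact (n + r) - u r n / exp 1) =
          \<bar>real (r_derangement_number r n) - fact n / exp 1 * real ((n - 1) choose r)\<bar> / fact (n + r)"
        by (simp del: fact_Suc)
      also have "\<dots> \<le> 2 * fact n * real ((n - 1) choose (r - 1)) / fact (n + r)"
        using r_derangement_number_bound[OF assms elim] by (intro divide_right_mono) auto
      also have "\<dots> = 2 * u q n * inverse (real (n + r))"
        by (simp add: u_def r field_simps)
      finally show ?case
        by simp
    qed
  qed
  moreover have "(\<lambda>n. u r n / exp 1) \<longlonglongrightarrow> 1 / fact r / exp 1"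
    by (intro tendsto_intros u) simp
  ultimately have "(\<lambda>n. (real (r_derangement_number r n) / fact (n + r) - u r n / exp 1) + u r n / exp 1)
      \<longlonglongrightarrow> 0 + 1 / fact r / exp 1"
    by (rule tendsto_add)
  then show ?thesis
    by simp
qed

theorem theorem6:
  shows "(\<forall>r n :: nat. 1 \<le> r \<longrightarrow> r \<le> n \<longrightarrow>
            \<bar>real (r_derangement_number r n) - fact n / exp 1 * real ((n - 1) choose r)\<bar>
              < 2 * fact n * real ((n - 1) choose (r - 1))) \<and>
         (\<forall>r :: nat. 1 \<le> r \<longrightarrow>
            (\<lambda>n. real (r_derangement_number r n) / fact (n + r)) \<longlonglongrightarrow> 1 / (fact r * exp 1))"
  using r_derangement_number_bound r_derangement_number_tendsto by blast

end
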